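(* Let $V$ be a real vector space, let $F$ be a square root closed, semiprime $f$-algebra, let $T\colon V\times V\to F$ be a vector semi-inner product, and let $u\in F^+$. Define $\|x\|^T_u:=T(x,x)\boxtimes u$ for $x\in V$. Then for all $x,y\in V$, \[ \|x+y\|^T_u\le\sqrt{(\|x\|^T_u+\|y\|^T_u)^2-\inf_{\lambda\in\mathbb{R}\setminus\{0\}}\{|\lambda|^{-1}(\|\lambda x-y\|^T_u)^2\}}\le \|x\|^T_u+\|y\|^T_u \] (where the infimum exists in $F$). Moreover, the equality \[ \|x+y\|^T_u=\sqrt{(\|x\|^T_u+\|y\|^T_u)^2-\inf_{\lambda\in\mathbb{R}\setminus\{0\}}\{|\lambda|^{-1}(\|\lambda x-y\|^T_u)^2\}} \] holds if and only if $T(x,y)u\in F^+$.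
   Context: All vector spaces are over $\mathbb{R}$ and all vector lattices are Archimedean; $F^+=\{x\in F:x\ge0\}$. An $f$-algebra is a vector lattice $F$ with an associative bilinear multiplication (written by juxtaposition) such that $xy\in F^+$ for $x,y\in F^+$, and $\inf\{x,y\}=0$ implies $\inf\{xz,y\}=\inf\{x,yz\}=0$ for all $z\in F^+$. It is semiprime if it has no nonzero nilpotent elements. A semiprime $f$-algebra is square root closed if for every $a\in F^+$ there is $b\in F^+$ with $b^2=a$; such $b$ is unique and is denoted $\sqrt{a}$. For $u,v\in F^+$, $u\boxtimes v:=2^{-1}\inf\{\theta u+\theta^{-1}v:\theta\in(0,\infty)\}$ (this infimum exists in the present setting). A map $T\colon V\times V\to F$ is a vector semi-inner product if it is bilinear, symmetric ($T(x,y)=T(y,x)$), and satisfies $T(x,x)\ge 0$ for all $x\in V$. *)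

theory Defs
  imports "HOL-Analysis.Analysis"
begin

class vector_lattice = ordered_real_vector + lattice

class archimedean_vector_lattice = vector_lattice +
  assumes archimedean: "0 \<le> x \<Longrightarrow> (\<forall>n::nat. real n *\<^sub>R x \<le> y) \<Longrightarrow> x = 0"

class f_algebra = archimedean_vector_lattice + real_algebra +
  assumes f_mult_nonneg: "0 \<le> x \<Longrightarrow> 0 \<le> y \<Longrightarrow> 0 \<le> x * y"
    and f_disjoint: "inf x y = 0 \<Longrightarrow> 0 \<le> z \<Longrightarrow> inf (x * z) y = 0 \<and> inf x (y * z) = 0"

text \<open>Powers without a unit: npow n x = x^(n+1).\<close>
fun npow :: "nat \<Rightarrow> 'a::times \<Rightarrow> 'a" where
  "npow 0 x = x"
| "npow (Suc n) x = npow n x * x"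

definition semiprime :: "'a::f_algebra itself \<Rightarrow> bool" where
  "semiprime _ \<longleftrightarrow> (\<forall>(x::'a) n. npow n x = 0 \<longrightarrow> x = 0)"

definition sqrt_closed :: "'a::f_algebra itself \<Rightarrow> bool" where
  "sqrt_closed _ \<longleftrightarrow> (\<forall>a::'a. 0 \<le> a \<longrightarrow> (\<exists>b. 0 \<le> b \<and> b * b = a))"

definition fsqrt :: "'a::f_algebra \<Rightarrow> 'a" where
  "fsqrt a = (THE b. 0 \<le> b \<and> b * b = a)"

definition is_infimum :: "'a::order set \<Rightarrow> 'a \<Rightarrow> bool" where
  "is_infimum S m \<longleftrightarrow> (\<forall>s\<in>S. m \<le> s) \<and> (\<forall>l. (\<forall>s\<in>S. l \<le> s) \<longrightarrow> l \<le> m)"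

definition boxtimes :: "'a::f_algebra \<Rightarrow> 'a \<Rightarrow> 'a" where
  "boxtimes u v = (1/2) *\<^sub>R (THE m. is_infimum
      {\<theta> *\<^sub>R u + inverse \<theta> *\<^sub>R v | \<theta>::real. 0 < \<theta>} m)"

definition vector_semi_inner_product :: "('v::real_vector \<Rightarrow> 'v \<Rightarrow> 'f::f_algebra) \<Rightarrow> bool" where
  "vector_semi_inner_product T \<longleftrightarrow>
     bilinear T \<and> (\<forall>x y. T x y = T y x) \<and> (\<forall>x. 0 \<le> T x x)"

definition Tnorm :: "('v \<Rightarrow> 'v \<Rightarrow> 'f::f_algebra) \<Rightarrow> 'f \<Rightarrow> 'v \<Rightarrow> 'f" where
  "Tnorm T u x = boxtimes (T x x) u"

end

theory Submission
  imports Defs "HOL-Library.Lattice_Algebras"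
begin

text \<open>Put \<open>A = T x x * u\<close>, \<open>C = T y y * u\<close> and \<open>D = T x y * u\<close>. Since \<open>boxtimes a b\<close> is the square root of
  \<open>a * b\<close>, the squared seminorm of \<open>z\<close> is \<open>T z z * u\<close>. Splitting the infimum over \<open>\<lambda>\<close> by the sign of \<open>\<lambda>\<close>
  therefore gives \<open>2 \<surd>(A C) - 2 |D|\<close>, so the square root in the theorem is \<open>\<surd>(A + C + 2 |D|)\<close>, to be
  compared with \<open>\<surd>(A + C + 2 D)\<close>.

  Commutativity of the product is not an axiom: it follows from semiprimeness and the Archimedean property, because
  positive orthomorphisms commute. All Archimedean limit arguments reduce to one grid estimate.\<close>

subsection \<open>Disjointness in vector lattices\<close>

instance vector_lattice \<subseteq> lattice_ab_group_add ..

lemma pprt_minus_pprt_uminus: "pprt x - pprt (- x) = (x :: 'a::vector_lattice)"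
  using prts[of x] by (simp add: pprt_neg)

lemma pprt_ge: "x \<le> pprt (x :: 'a::vector_lattice)"
  by (simp add: pprt_def)

lemma pprt_le: "x \<le> y \<Longrightarrow> 0 \<le> y \<Longrightarrow> pprt (x :: 'a::vector_lattice) \<le> y"
  by (simp add: pprt_def)

lemma inf_pprt_pprt_uminus: "inf (pprt x) (pprt (- x)) = (0 :: 'a::vector_lattice)"
proof -
  have "inf (pprt x) (pprt (- x)) = inf (x + pprt (- x)) (0 + pprt (- x))"
    using pprt_minus_pprt_uminus[of x] by (simp add: diff_eq_eq)
  also have "\<dots> = nprt x + pprt (- x)"
    by (simp only: add_inf_distrib_right nprt_def)
  finally show ?thesis by (simp add: pprt_neg)
qed

lemma disjoint_mono:
  fixes a :: "'a::vector_lattice"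
  assumes "inf a b = 0" "0 \<le> a'" "a' \<le> a" "0 \<le> b'" "b' \<le> b"
  shows "inf a' b' = 0"
  using inf_mono[OF assms(3,5)] assms by (intro antisym) auto

text \<open>Subtracting \<open>c\<close> from the left side leaves an element below both
  \<open>a\<close> and \<open>b\<close>, so the left side is at most \<open>inf a b + c\<close>. It
  is also at most \<open>inf a b + a\<close>, and the infimum of these two bounds is the right
  side.\<close>

lemma inf_add_le:
  fixes a :: "'a::vector_lattice"
  assumes "0 \<le> a" "0 \<le> b" "0 \<le> c"
  shows "inf a (b + c) \<le> inf a b + inf a c"
proof -
  let ?t = "inf a (b + c)"
  have "?t - c \<le> a"
    using inf_le1[of a "b + c"] assms(3) by (simp add: diff_le_eq add_increasing2)
  moreover have "?t - c \<le> b"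
    by (simp add: diff_le_eq)
  ultimately have "?t \<le> inf a b + c"
    by (simp flip: diff_le_eq)
  moreover have "?t \<le> inf a b + a"
    using assms by (intro add_increasing) auto
  ultimately show ?thesis
    by (simp add: add_inf_distrib_left)
qed

lemma disjoint_add:
  fixes a :: "'a::vector_lattice"
  assumes "inf a b = 0" "inf a c = 0"
  shows "inf a (b + c) = 0"
proof -
  have "0 \<le> a" "0 \<le> b" "0 \<le> c"
    using assms by (metis inf_le1 inf_le2)+
  with inf_add_le[of a b c] assms show ?thesis by (intro antisym) auto
qed

text \<open>\<open>inf_add_le\<close> bounds \<open>a = inf a (b + c)\<close> by
  \<open>inf a b + 0\<close>. Cancelling a disjoint summand in this way replaces pointwise arguments
  below.\<close>

lemma disjoint_le_add:
  fixes a :: "'a::vector_lattice"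
  assumes "a \<le> b + c" "inf a c = 0" "0 \<le> b"
  shows "a \<le> b"
proof -
  have "0 \<le> a" "0 \<le> c"
    using assms by (metis inf_le1 inf_le2)+
  then have "a \<le> inf a b"
    using inf_add_le[of a b c] assms by (simp add: inf_absorb1)
  then show ?thesis by simp
qed

lemma disjoint_self: "inf a b = 0 \<Longrightarrow> a \<le> b \<Longrightarrow> a = (0 :: 'a::vector_lattice)"
  by (simp add: inf_absorb1)

lemma disjoint_scaleR:
  fixes a :: "'a::vector_lattice"
  assumes "inf a b = 0" "0 \<le> r"
  shows "inf (r *\<^sub>R a) b = 0"
proof (cases "r = 0")
  case True
  then show ?thesis using assms by (metis inf_absorb1 inf_le2 scaleR_zero_left)
next
  case False
  with assms have r: "0 < r" by simp
  \<comment> \<open>The factor \<open>m\<close> dominates both coefficients \<open>r\<close> and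
    \<open>1\<close>, so \<open>?t\<close> divided by \<open>m\<close> lies below
    \<open>inf a b\<close>.\<close>
  define m where "m = max 1 r"
  have m: "1 \<le> m" "r \<le> m" "0 < m" by (auto simp: m_def)
  have ab: "0 \<le> a" "0 \<le> b" using assms by (metis inf_le1 inf_le2)+
  let ?t = "inf (r *\<^sub>R a) b"
  have t0: "0 \<le> ?t" using ab r by (simp add: scaleR_nonneg_nonneg)
  have "?t \<le> m *\<^sub>R a"
    using scaleR_right_mono[OF m(2) ab(1)] by (meson inf_le1 order_trans)
  moreover have "?t \<le> m *\<^sub>R b"
    using scaleR_right_mono[OF m(1) ab(2)] by (metis inf_le2 order_trans scaleR_one)
  ultimately have "inverse m *\<^sub>R ?t \<le> inf a b"
    using m(3) by (simp add: pos_le_divideR_eq divideR_right pos_divideR_le_eq)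
  then have "inverse m *\<^sub>R ?t \<le> 0" by (simp add: assms)
  then have "m *\<^sub>R (inverse m *\<^sub>R ?t) \<le> m *\<^sub>R 0"
    using m(3) by (intro scaleR_left_mono) auto
  with m(3) t0 show ?thesis by (intro antisym) auto
qed

section \<open>The modulus and the grid estimate\<close>

definition modulus :: "'a::vector_lattice \<Rightarrow> 'a" where
  "modulus x = pprt x + pprt (- x)"

lemma modulus_nonneg: "0 \<le> modulus x"
  by (simp add: modulus_def)

lemma modulus_minus: "modulus (- x) = modulus x"
  by (simp add: modulus_def add.commute)

lemma modulus_ge: "x \<le> modulus x" "- x \<le> modulus x"
  unfolding modulus_def by (simp_all add: pprt_ge add_increasing add_increasing2)

text \<open>Disjoint elements add up to their supremum, so any common upper bound of the two
  positive parts bounds their sum.\<close>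

lemma modulus_le: "x \<le> y \<Longrightarrow> - x \<le> y \<Longrightarrow> modulus x \<le> y"
proof -
  assume *: "x \<le> y" "- x \<le> y"
  from add_mono[OF *] have "0 \<le> y" by simp
  with * have "pprt x \<le> y" "pprt (- x) \<le> y" by (auto intro: pprt_le)
  then have "sup (pprt x) (pprt (- x)) \<le> y" by simp
  then show ?thesis
    using add_eq_inf_sup[of "pprt x" "pprt (- x)"]
    by (simp add: modulus_def inf_pprt_pprt_uminus)
qed

lemma modulus_eq_0: "modulus x = 0 \<Longrightarrow> x = 0"
  using modulus_ge[of x] by (intro antisym) auto

text \<open>If \<open>w\<close> lies between \<open>0\<close> and \<open>K h\<close>, then in any totally ordered quotient it has distance at
  most \<open>h\<close> from one of the grid points \<open>h, 2 h, \<dots>, K h\<close>.\<close>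

lemma grid_bound:
  fixes d h w :: "'a::vector_lattice"
  assumes "0 \<le> h" "0 \<le> w" "1 \<le> K"
    and "\<And>k. 1 \<le> k \<Longrightarrow> k \<le> K \<Longrightarrow> d \<le> modulus (w - real k *\<^sub>R h)"
  shows "d \<le> pprt (w - real K *\<^sub>R h) + h"
  using assms(3,4)
proof (induction K rule: dec_induct)
  case base
  have "d \<le> modulus (w - h)" using base[of 1] by simp
  also have "\<dots> \<le> pprt (w - h) + h"
    unfolding modulus_def using assms(1,2) by (intro add_left_mono pprt_le) auto
  finally show ?case by simp
next
  case (step K)
  define y where "y = w - real (Suc K) *\<^sub>R h"
  have yh: "w - real K *\<^sub>R h = y + h"
    by (simp add: y_def algebra_simps)
  have 1: "d \<le> pprt (y + h) + h"
    using step.IH step.prems yh by simp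
  have 2: "d \<le> modulus y"
    using step.prems[of "Suc K"] by (simp add: y_def)
  \<comment> \<open>\<open>r\<close> measures how far the claim fails. The induction hypothesis puts
    it below the positive part of \<open>y + h\<close>, the new grid point puts it below that of
    \<open>- (y + h)\<close>, and these are disjoint.\<close>
  define r where "r = pprt (d - h - pprt y)"
  have "r \<le> pprt (y + h)"
    unfolding r_def
  proof (rule pprt_le)
    have "d \<le> pprt y + (pprt (y + h) + h)"
      using 1 by (rule add_increasing[OF zero_le_pprt])
    then show "d - h - pprt y \<le> pprt (y + h)" by (simp add: algebra_simps)
  qed simp
  moreover have "r \<le> pprt (- (y + h))"
    unfolding r_def
  proof (rule pprt_le)
    have "pprt (- y) \<le> pprt (- (y + h)) + h"
    proof (rule pprt_le)
      have "- (y + h) + h \<le> pprt (- (y + h)) + h"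
        by (intro add_right_mono pprt_ge)
      then show "- y \<le> pprt (- (y + h)) + h" by simp
    qed (use assms(1) in simp)
    with 2 have "d \<le> pprt y + (pprt (- (y + h)) + h)"
      unfolding modulus_def by (meson add_left_mono order_trans)
    then show "d - h - pprt y \<le> pprt (- (y + h))"
      by (simp add: algebra_simps)
  qed simp
  ultimately have "r \<le> inf (pprt (y + h)) (pprt (- (y + h)))"
    by simp
  then have "r = 0"
    by (simp only: inf_pprt_pprt_uminus) (simp add: r_def antisym)
  then have "d - h - pprt y \<le> 0"
    by (simp add: r_def le_zero_iff_zero_pprt)
  then show ?case by (simp add: y_def algebra_simps)
qed

text \<open>The axiom at \<open>n = 0\<close> asks for \<open>0 \<le> y\<close>, which the case
  \<open>n = 1\<close> supplies. This form lets limit arguments divide by \<open>n\<close>.\<close>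

lemma archimedean_pos:
  fixes x y :: "'a::archimedean_vector_lattice"
  assumes "0 \<le> x" and "\<And>n. 0 < n \<Longrightarrow> real n *\<^sub>R x \<le> y"
  shows "x = 0"
proof (rule archimedean[OF assms(1)], rule allI)
  fix n :: nat
  have "0 \<le> y" using assms(1) assms(2)[of 1] by simp
  then show "real n *\<^sub>R x \<le> y" using assms(2)[of n] by (cases "n = 0") auto
qed

subsection \<open>Positive orthomorphisms commute\<close>

definition pos_orthomorphism :: "('a::vector_lattice \<Rightarrow> 'a) \<Rightarrow> bool" where
  "pos_orthomorphism \<pi> \<longleftrightarrow> linear \<pi> \<and> (\<forall>x. 0 \<le> x \<longrightarrow> 0 \<le> \<pi> x)
     \<and> (\<forall>x y. inf x y = 0 \<longrightarrow> inf (\<pi> x) y = 0)"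

lemma pos_orthomorphismD:
  assumes "pos_orthomorphism \<pi>"
  shows "linear \<pi>" "0 \<le> x \<Longrightarrow> 0 \<le> \<pi> x" "inf x y = 0 \<Longrightarrow> inf (\<pi> x) y = 0"
    "inf x y = 0 \<Longrightarrow> inf x (\<pi> y) = 0"
  using assms unfolding pos_orthomorphism_def by (auto simp: inf_commute)

lemma pos_orthomorphism_mono:
  assumes "pos_orthomorphism \<pi>" "x \<le> y"
  shows "\<pi> x \<le> \<pi> y"
  using pos_orthomorphismD(2)[OF assms(1), of "y - x"] assms(2)
  by (simp add: linear_diff[OF pos_orthomorphismD(1)[OF assms(1)]])

lemma pos_orthomorphism_scaleR:
  "0 \<le> c \<Longrightarrow> pos_orthomorphism (\<lambda>x::'a::vector_lattice. c *\<^sub>R x)"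
  unfolding pos_orthomorphism_def
  by (auto intro: disjoint_scaleR scaleR_nonneg_nonneg)

lemma pos_orthomorphism_add:
  assumes "pos_orthomorphism \<pi>" "pos_orthomorphism \<rho>"
  shows "pos_orthomorphism (\<lambda>x. \<pi> x + \<rho> x)"
  using assms unfolding pos_orthomorphism_def
  by (auto intro: linear_compose_add disjoint_add simp: inf_commute[of "_ + _"] inf_commute)

text \<open>The images of the positive and negative parts of \<open>x\<close> stay disjoint, so
  their difference \<open>\<pi> x\<close> is already split into its own positive and negative
  parts.\<close>

lemma pos_orthomorphism_pprt:
  assumes \<pi>: "pos_orthomorphism \<pi>"
  shows "\<pi> (pprt x) = pprt (\<pi> x)"
proof -
  have eq: "\<pi> x = \<pi> (pprt x) - \<pi> (pprt (- x))"
    by (metis linear_diff[OF pos_orthomorphismD(1)[OF \<pi>]] pprt_minus_pprt_uminus)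
  have disj: "inf (\<pi> (pprt x)) (\<pi> (pprt (- x))) = 0"
    by (intro pos_orthomorphismD(3,4)[OF \<pi>] inf_pprt_pprt_uminus)
  show ?thesis
  proof (rule antisym)
    have "\<pi> (pprt x) = \<pi> x + \<pi> (pprt (- x))" using eq by simp
    also have "\<dots> \<le> pprt (\<pi> x) + \<pi> (pprt (- x))"
      by (intro add_right_mono pprt_ge)
    finally show "\<pi> (pprt x) \<le> pprt (\<pi> x)"
      using disj by (rule disjoint_le_add) simp
    show "pprt (\<pi> x) \<le> \<pi> (pprt x)"
      by (intro pprt_le pos_orthomorphism_mono[OF \<pi>] pprt_ge pos_orthomorphismD(2)[OF \<pi>]) simp
  qed
qed

lemma pos_orthomorphism_modulus:
  assumes "pos_orthomorphism \<pi>"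
  shows "\<pi> (modulus x) = modulus (\<pi> x)"
  using pos_orthomorphismD(1)[OF assms]
  by (simp add: modulus_def linear_add linear_neg pos_orthomorphism_pprt[OF assms])

text \<open>Both positive parts dominate their infimum \<open>p\<close>, so \<open>p\<close> is bounded by the modulus of
  \<open>\<sigma> (\<alpha> v - (1 - \<alpha>) w)\<close> for all \<open>\<alpha> \<in> [0, 1]\<close>, where \<open>\<sigma> = \<pi> - \<rho>\<close>; but locally some \<open>\<alpha>\<close> almost annihilates
  \<open>\<alpha> v - (1 - \<alpha>) w\<close>.\<close>

lemma orthomorphism_diff_disjoint:
  fixes \<pi> \<rho> :: "'a::archimedean_vector_lattice \<Rightarrow> 'a"
  assumes \<pi>: "pos_orthomorphism \<pi>" and \<rho>: "pos_orthomorphism \<rho>"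
    and v: "0 \<le> v" and w: "0 \<le> w"
  shows "inf (pprt (\<pi> v - \<rho> v)) (pprt (\<rho> w - \<pi> w)) = 0"
proof -
  define \<sigma> where "\<sigma> x = \<pi> x - \<rho> x" for x
  \<comment> \<open>\<open>\<sigma>\<close> may fail to be positive, but \<open>\<tau>\<close> is a
    positive orthomorphism and commutes with the modulus, which yields
    \<open>\<sigma> z \<le> modulus (\<tau> z)\<close>.\<close>
  define \<tau> where "\<tau> x = \<pi> x + \<rho> x" for x
  note lin = pos_orthomorphismD(1)[OF \<pi>] pos_orthomorphismD(1)[OF \<rho>]
  have \<tau>: "pos_orthomorphism \<tau>"
    unfolding \<tau>_def[abs_def] by (rule pos_orthomorphism_add[OF \<pi> \<rho>])
  note lint = pos_orthomorphismD(1)[OF \<tau>]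
  define p where "p = inf (pprt (\<sigma> v)) (pprt (- \<sigma> w))"
  have p0: "0 \<le> p" by (simp add: p_def)
  define s where "s = v + w"
  have pv: "inf p (pprt (- \<sigma> v)) = 0"
    by (rule disjoint_mono[OF inf_pprt_pprt_uminus[of "\<sigma> v"] p0]) (simp_all add: p_def)
  have pw: "inf p (pprt (\<sigma> w)) = 0"
    using disjoint_mono[OF inf_pprt_pprt_uminus[of "- \<sigma> w"] p0, of "pprt (\<sigma> w)"]
    by (simp add: p_def)
  have key: "real n *\<^sub>R p \<le> modulus (real n *\<^sub>R \<tau> w - real k *\<^sub>R \<tau> s)"
    if "k \<le> n" for k n :: nat
  proof -
    \<comment> \<open>The weights are \<open>\<alpha>\<close> and \<open>1 - \<alpha>\<close> scaled
      by \<open>n\<close>. Written through \<open>s\<close>, this makes \<open>\<tau> z\<close> a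
      grid point minus \<open>n *\<^sub>R \<tau> w\<close>.\<close>
    define z where "z = real k *\<^sub>R v - real (n - k) *\<^sub>R w"
    have zs: "z = real k *\<^sub>R s - real n *\<^sub>R w"
      using that by (simp add: z_def s_def algebra_simps of_nat_diff)
    have \<sigma>z: "\<sigma> z = real k *\<^sub>R \<sigma> v - real (n - k) *\<^sub>R \<sigma> w"
      unfolding z_def \<sigma>_def using lin
      by (simp add: linear_diff linear_scale algebra_simps)
    have "real n *\<^sub>R p = real k *\<^sub>R p + real (n - k) *\<^sub>R p"
      using that by (simp add: of_nat_diff flip: scaleR_add_left)
    also have "\<dots> \<le> real k *\<^sub>R pprt (\<sigma> v) + real (n - k) *\<^sub>R pprt (- \<sigma> w)"
      by (intro add_mono scaleR_left_mono) (auto simp: p_def)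
    \<comment> \<open>The remainder in brackets is disjoint from \<open>p\<close> by
      \<open>pv\<close> and \<open>pw\<close>, so it can be cancelled at the end.\<close>
    also have "\<dots> = \<sigma> z + (real k *\<^sub>R pprt (- \<sigma> v) + real (n - k) *\<^sub>R pprt (\<sigma> w))"
    proof -
      have "pprt (\<sigma> v) = \<sigma> v + pprt (- \<sigma> v)" "pprt (- \<sigma> w) = pprt (\<sigma> w) - \<sigma> w"
        using pprt_minus_pprt_uminus[of "\<sigma> v"] pprt_minus_pprt_uminus[of "\<sigma> w"]
        by (simp_all add: algebra_simps)
      then show ?thesis by (simp only: \<sigma>z) (simp add: algebra_simps)
    qed
    also have "\<dots> \<le> modulus (\<tau> z) + (real k *\<^sub>R pprt (- \<sigma> v) + real (n - k) *\<^sub>R pprt (\<sigma> w))"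
    proof (rule add_right_mono)
      have "\<pi> z \<le> \<pi> (modulus z)" "\<rho> (- z) \<le> \<rho> (modulus z)"
        by (intro pos_orthomorphism_mono[OF \<pi>] pos_orthomorphism_mono[OF \<rho>] modulus_ge)+
      then have "\<sigma> z \<le> \<tau> (modulus z)"
        unfolding \<sigma>_def \<tau>_def linear_neg[OF lin(2)] using add_mono by fastforce
      then show "\<sigma> z \<le> modulus (\<tau> z)"
        by (simp add: pos_orthomorphism_modulus[OF \<tau>])
    qed
    finally have "real n *\<^sub>R p \<le> modulus (\<tau> z)"
    proof (rule disjoint_le_add)
      show "inf (real n *\<^sub>R p) (real k *\<^sub>R pprt (- \<sigma> v) + real (n - k) *\<^sub>R pprt (\<sigma> w)) = 0"
        by (intro disjoint_add disjoint_scaleR)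
          (simp_all add: inf_commute[of p] pv[unfolded inf_commute[of p]]
             pw[unfolded inf_commute[of p]] disjoint_scaleR inf_commute[of p "_ *\<^sub>R _"])
    qed (rule modulus_nonneg)
    then show ?thesis
      using modulus_minus[of "\<tau> z"]
      by (simp add: zs linear_diff[OF lint] linear_scale[OF lint])
  qed
  have \<tau>w: "0 \<le> \<tau> w" and \<tau>s: "0 \<le> \<tau> s" and \<tau>ws: "\<tau> w \<le> \<tau> s"
    using v w by (auto simp: s_def intro!: pos_orthomorphismD(2)[OF \<tau>] pos_orthomorphism_mono[OF \<tau>])
  have "p = 0"
  proof (rule archimedean_pos[OF p0])
    fix n :: nat
    assume "0 < n"
    \<comment> \<open>The last point of the grid with mesh \<open>\<tau> s\<close> lies above
      \<open>n *\<^sub>R \<tau> w\<close>, so no excess remains and the bound is independent of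
      \<open>n\<close>.\<close>
    then have "real n *\<^sub>R p \<le> pprt (real n *\<^sub>R \<tau> w - real n *\<^sub>R \<tau> s) + \<tau> s"
      using \<tau>s \<tau>w key by (intro grid_bound) (auto intro: scaleR_nonneg_nonneg)
    also have "pprt (real n *\<^sub>R \<tau> w - real n *\<^sub>R \<tau> s) = 0"
      using \<tau>ws by (intro pprt_eq_0) (simp add: scaleR_left_mono)
    finally show "real n *\<^sub>R p \<le> \<tau> s" by simp
  qed
  then show ?thesis by (simp add: p_def \<sigma>_def)
qed

text \<open>The hypotheses exclude opposite signs, so \<open>pprt x + pprt y\<close> is disjoint
  from the sum of the negative parts and is bounded by \<open>pprt (x + y)\<close>. The same
  argument for \<open>- x\<close> and \<open>- y\<close> gives the other half.\<close>

lemma modulus_add_same_sign: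
  fixes x y :: "'a::vector_lattice"
  assumes "inf (pprt x) (pprt (- y)) = 0" "inf (pprt (- x)) (pprt y) = 0"
  shows "modulus x + modulus y \<le> modulus (x + y)"
proof -
  have *: "pprt x + pprt y \<le> pprt (x + y)"
    if "inf (pprt x) (pprt (- y)) = 0" "inf (pprt (- x)) (pprt y) = 0" for x y :: 'a
  proof (rule disjoint_le_add)
    have "pprt x + pprt y = (x + y) + (pprt (- x) + pprt (- y))"
      using pprt_minus_pprt_uminus[of x] pprt_minus_pprt_uminus[of y]
      by (simp add: algebra_simps)
    also have "\<dots> \<le> pprt (x + y) + (pprt (- x) + pprt (- y))"
      by (intro add_right_mono pprt_ge)
    finally show "pprt x + pprt y \<le> pprt (x + y) + (pprt (- x) + pprt (- y))" .
    have "inf (pprt (- x) + pprt (- y)) (pprt x + pprt y) = 0"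
      using that inf_pprt_pprt_uminus[of x] inf_pprt_pprt_uminus[of y]
      by (intro disjoint_add; subst inf_commute; intro disjoint_add)
        (simp_all add: inf_commute)
    then show "inf (pprt x + pprt y) (pprt (- x) + pprt (- y)) = 0"
      by (simp add: inf_commute)
  qed simp
  show ?thesis
    using add_mono[OF *[OF assms] *[of "- x" "- y"]] assms
    by (simp add: modulus_def algebra_simps)
qed

text \<open>The infimum is disjoint from the negative part of \<open>W - m *\<^sub>R w\<close>,
  which bounds the excess of \<open>m *\<^sub>R w\<close> over \<open>W\<close>. This controls the
  overshoot past the last grid point in the commutator estimate.\<close>

lemma inf_pprt_diff_le:
  fixes w W :: "'a::vector_lattice"
  assumes "0 \<le> w" "0 \<le> W" "0 \<le> m"
  shows "m *\<^sub>R inf (pprt (W - m *\<^sub>R w)) w \<le> W"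
proof (rule disjoint_le_add)
  let ?r = "inf (pprt (W - m *\<^sub>R w)) w"
  have "m *\<^sub>R ?r \<le> m *\<^sub>R w"
    using assms by (intro scaleR_left_mono) auto
  also have "m *\<^sub>R w = W + - (W - m *\<^sub>R w)" by simp
  also have "\<dots> \<le> W + pprt (- (W - m *\<^sub>R w))"
    by (intro add_left_mono pprt_ge)
  finally show "m *\<^sub>R ?r \<le> W + pprt (- (W - m *\<^sub>R w))" .
  show "inf (m *\<^sub>R ?r) (pprt (- (W - m *\<^sub>R w))) = 0"
    using assms
    by (intro disjoint_scaleR disjoint_mono[OF inf_pprt_pprt_uminus[of "W - m *\<^sub>R w"]]) auto
qed (rule assms)

text \<open>With \<open>A = \<rho> (\<pi> v)\<close>, \<open>B = \<pi> (\<rho> v)\<close> and \<open>w = \<rho> v\<close>, the elements \<open>A - c w\<close> and \<open>B - c w\<close> have the same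
  sign for every \<open>c \<ge> 0\<close>, hence the modulus of \<open>A - B\<close> is at most that of \<open>A + B - 2 c w\<close>.\<close>

lemma commutator_disjoint:
  fixes \<pi> \<rho> :: "'a::archimedean_vector_lattice \<Rightarrow> 'a"
  assumes \<pi>: "pos_orthomorphism \<pi>" and \<rho>: "pos_orthomorphism \<rho>" and v: "0 \<le> v"
  shows "inf (modulus (\<rho> (\<pi> v) - \<pi> (\<rho> v))) (\<rho> v) = 0"
proof -
  define A B w where "A = \<rho> (\<pi> v)" and "B = \<pi> (\<rho> v)" and "w = \<rho> v"
  have w: "0 \<le> w" and A: "0 \<le> A" and B: "0 \<le> B"
    unfolding A_def B_def w_def using v \<pi> \<rho> by (auto intro: pos_orthomorphismD)
  define d where "d = modulus (A - B)"
  have d0: "0 \<le> d" by (simp add: d_def modulus_nonneg)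
  have key: "d \<le> modulus ((A + B) - (2 * c) *\<^sub>R w)" if c: "0 \<le> c" for c
  proof -
    note cI = pos_orthomorphism_scaleR[OF c]
    have Acw: "A - c *\<^sub>R w = \<rho> (\<pi> v - c *\<^sub>R v)"
      using pos_orthomorphismD(1)[OF \<rho>] by (simp add: A_def w_def linear_diff linear_scale)
    \<comment> \<open>\<open>\<pi>\<close> is compared with the scalar \<open>c\<close> at
      \<open>v\<close> and at \<open>w\<close>; applying \<open>\<rho>\<close> to the first factor
      then produces \<open>A - c *\<^sub>R w\<close>.\<close>
    have 1: "inf (pprt (A - c *\<^sub>R w)) (pprt (- (B - c *\<^sub>R w))) = 0"
      unfolding Acw pos_orthomorphism_pprt[OF \<rho>, symmetric]
      using orthomorphism_diff_disjoint[OF \<pi> cI v w]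
      by (intro pos_orthomorphismD(3)[OF \<rho>]) (simp add: B_def w_def)
    have "- (A - c *\<^sub>R w) = \<rho> (c *\<^sub>R v - \<pi> v)"
      unfolding Acw using linear_neg[OF pos_orthomorphismD(1)[OF \<rho>], of "\<pi> v - c *\<^sub>R v"] by simp
    then have 2: "inf (pprt (- (A - c *\<^sub>R w))) (pprt (B - c *\<^sub>R w)) = 0"
      using pos_orthomorphismD(3)[OF \<rho> orthomorphism_diff_disjoint[OF cI \<pi> v w]]
      by (simp add: pos_orthomorphism_pprt[OF \<rho>] B_def w_def)
    have "d \<le> modulus (A - c *\<^sub>R w) + modulus (B - c *\<^sub>R w)"
      unfolding d_def
    proof (rule modulus_le)
      show "A - B \<le> modulus (A - c *\<^sub>R w) + modulus (B - c *\<^sub>R w)"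
        using add_mono[OF modulus_ge(1)[of "A - c *\<^sub>R w"] modulus_ge(2)[of "B - c *\<^sub>R w"]] by simp
      show "- (A - B) \<le> modulus (A - c *\<^sub>R w) + modulus (B - c *\<^sub>R w)"
        using add_mono[OF modulus_ge(2)[of "A - c *\<^sub>R w"] modulus_ge(1)[of "B - c *\<^sub>R w"]] by simp
    qed
    also have "\<dots> \<le> modulus ((A - c *\<^sub>R w) + (B - c *\<^sub>R w))"
      by (rule modulus_add_same_sign[OF 1 2])
    also have "(A - c *\<^sub>R w) + (B - c *\<^sub>R w) = (A + B) - (2 * c) *\<^sub>R w"
      by (simp add: scaleR_2 algebra_simps flip: scaleR_scaleR)
    finally show ?thesis .
  qed
  have "inf d w = 0"
  proof (rule archimedean_pos)
    show "0 \<le> inf d w" using d0 w by simp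
    fix n :: nat
    assume n: "0 < n"
    \<comment> \<open>A grid of \<open>n * n\<close> points with mesh \<open>h\<close> reaches
      \<open>n *\<^sub>R w\<close>; its \<open>k\<close>-th point is \<open>key\<close> at
      \<open>c = k / (2 * n)\<close>.\<close>
    define h where "h = inverse (real n) *\<^sub>R w"
    have h: "0 \<le> h" using w by (simp add: h_def scaleR_nonneg_nonneg)
    have nh: "real n *\<^sub>R h = w" using n by (simp add: h_def)
    have "d \<le> pprt ((A + B) - real (n * n) *\<^sub>R h) + h"
    proof (rule grid_bound[OF h])
      show "d \<le> modulus (A + B - real k *\<^sub>R h)" for k
        using key[of "real k / (2 * real n)"] by (simp add: h_def field_simps)
    qed (use A B n in auto)
    then have d: "d \<le> pprt ((A + B) - real n *\<^sub>R w) + h"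
      by (simp add: nh flip: scaleR_scaleR)
    \<comment> \<open>Cutting down to \<open>w\<close> tames the overshoot: by
      \<open>inf_pprt_diff_le\<close>, even \<open>n\<close> times it stays below
      \<open>A + B\<close>.\<close>
    have "inf d w \<le> inf w (pprt ((A + B) - real n *\<^sub>R w) + h)"
      using d by (simp add: le_infI1)
    also have "\<dots> \<le> inf (pprt ((A + B) - real n *\<^sub>R w)) w + h"
      using inf_add_le[of w "pprt ((A + B) - real n *\<^sub>R w)" h] w h
      by (simp add: inf_commute) (meson add_left_mono inf_le2 inf_le1 order_trans)
    finally have "real n *\<^sub>R inf d w \<le> real n *\<^sub>R inf (pprt ((A + B) - real n *\<^sub>R w)) w + w"
      using scaleR_left_mono[of "inf d w" _ "real n"] nh by (fastforce simp: scaleR_add_right)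
    also have "\<dots> \<le> (A + B) + w"
      using A B w by (intro add_right_mono inf_pprt_diff_le) auto
    finally show "real n *\<^sub>R inf d w \<le> (A + B) + w" .
  qed
  then show ?thesis by (simp add: d_def A_def B_def w_def)
qed

text \<open>For \<open>v \<ge> 0\<close> the modulus of the commutator is disjoint from
  \<open>\<rho> v\<close> and \<open>\<pi> v\<close>, hence from
  \<open>\<rho> (\<pi> v) + \<pi> (\<rho> v)\<close>. That sum also dominates it, so it
  vanishes.\<close>

lemma orthomorphisms_commute:
  fixes \<pi> \<rho> :: "'a::archimedean_vector_lattice \<Rightarrow> 'a"
  assumes \<pi>: "pos_orthomorphism \<pi>" and \<rho>: "pos_orthomorphism \<rho>"
  shows "\<rho> (\<pi> v) = \<pi> (\<rho> v)"
proof -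
  have *: "\<rho> (\<pi> v) = \<pi> (\<rho> v)" if v: "0 \<le> v" for v
  proof -
    let ?d = "modulus (\<rho> (\<pi> v) - \<pi> (\<rho> v))"
    have nn: "0 \<le> \<rho> (\<pi> v)" "0 \<le> \<pi> (\<rho> v)"
      using v \<pi> \<rho> by (auto intro: pos_orthomorphismD)
    have "inf ?d (\<rho> v) = 0" "inf ?d (\<pi> v) = 0"
      using commutator_disjoint[OF \<pi> \<rho> v] commutator_disjoint[OF \<rho> \<pi> v]
        modulus_minus[of "\<rho> (\<pi> v) - \<pi> (\<rho> v)"] by simp_all
    then have "inf ?d (\<rho> (\<pi> v) + \<pi> (\<rho> v)) = 0"
      using pos_orthomorphismD(4)[OF \<pi>] pos_orthomorphismD(4)[OF \<rho>] by (blast intro: disjoint_add)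
    moreover have "?d \<le> \<rho> (\<pi> v) + \<pi> (\<rho> v)"
      using nn by (intro modulus_le) (simp_all add: diff_le_eq add_increasing2 add.assoc)
    ultimately have "?d = 0" by (rule disjoint_self)
    from modulus_eq_0[OF this] show ?thesis by simp
  qed
  have "\<rho> (\<pi> (pprt v - pprt (- v))) = \<pi> (\<rho> (pprt v - pprt (- v)))"
    using pos_orthomorphismD(1)[OF \<pi>] pos_orthomorphismD(1)[OF \<rho>]
    by (simp add: linear_diff *)
  then show ?thesis by (simp only: pprt_minus_pprt_uminus)
qed

subsection \<open>Semiprime f-algebras\<close>

lemma pos_orthomorphism_mult_right:
  "0 \<le> z \<Longrightarrow> pos_orthomorphism (\<lambda>x::'a::f_algebra. x * z)"
  unfolding pos_orthomorphism_def
  by (auto intro: f_mult_nonneg simp: f_disjoint linear_iff algebra_simps)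

lemma f_mult_mono:
  fixes a b c d :: "'a::f_algebra"
  assumes "a \<le> b" "c \<le> d" "0 \<le> b" "0 \<le> c"
  shows "a * c \<le> b * d"
proof -
  have "0 \<le> (b - a) * c + b * (d - c)"
    using assms by (intro add_nonneg_nonneg f_mult_nonneg) auto
  then show ?thesis by (simp add: algebra_simps)
qed

lemma is_infimum_The:
  assumes "is_infimum S m"
  shows "(THE m. is_infimum S m) = m"
  using assms by (intro the_equality) (auto simp: is_infimum_def intro: antisym)

context
  assumes semiprime: "semiprime TYPE('a::f_algebra)"
begin

lemma square_eq_0: "x * x = 0 \<Longrightarrow> x = (0 :: 'a)"
  using semiprime unfolding semiprime_def by (metis npow.simps)

lemma cube_eq_0: "x * x * x = 0 \<Longrightarrow> x = (0 :: 'a)"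
  using semiprime unfolding semiprime_def by (metis npow.simps)

text \<open>Only right multiplications are assumed to preserve disjointness. They commute as
  orthomorphisms, so right multiplication by a commutator is zero.\<close>

lemma f_mult_commute: "x * y = y * (x :: 'a)"
proof -
  have *: "z * w = w * z" if "0 \<le> z" "0 \<le> w" for z w :: 'a
  proof -
    have "c * (z * w - w * z) = 0" for c
      using orthomorphisms_commute[OF pos_orthomorphism_mult_right[OF that(1)]
          pos_orthomorphism_mult_right[OF that(2)], of c]
      by (simp add: algebra_simps)
    \<comment> \<open>Taking \<open>c\<close> to be the commutator itself makes its square
      zero.\<close>
    from square_eq_0[OF this] show ?thesis by simp
  qed
  have "(pprt x - pprt (- x)) * (pprt y - pprt (- y)) = (pprt y - pprt (- y)) * (pprt x - pprt (- x))"
    by (simp add: algebra_simps *[of "pprt x"] *[of "pprt (- x)"])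
  then show ?thesis by (simp only: pprt_minus_pprt_uminus)
qed

text \<open>Multiplying each factor by the other keeps them disjoint, and by commutativity the two
  products coincide.\<close>

lemma disjoint_mult_eq_0:
  fixes x y :: 'a
  assumes "inf x y = 0"
  shows "x * y = 0"
proof -
  have "0 \<le> x" "0 \<le> y" using assms by (metis inf_le1 inf_le2)+
  with assms have "inf (x * y) (y * x) = 0" by (simp add: f_disjoint)
  then show ?thesis by (simp add: f_mult_commute[of y])
qed

lemma modulus_square: "modulus x * modulus x = x * (x :: 'a)"
proof -
  have 0: "pprt x * pprt (- x) = 0" "pprt (- x) * pprt x = 0"
    using disjoint_mult_eq_0[OF inf_pprt_pprt_uminus[of x]] by (simp_all add: f_mult_commute)
  have "x * x = (pprt x - pprt (- x)) * (pprt x - pprt (- x))"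
    by (simp only: pprt_minus_pprt_uminus)
  then show ?thesis using 0 by (simp add: modulus_def algebra_simps)
qed

lemma f_square_nonneg: "0 \<le> x * (x :: 'a)"
  using f_mult_nonneg[OF modulus_nonneg modulus_nonneg, of x x] by (simp add: modulus_square)

text \<open>For \<open>d = pprt (a - b)\<close> one has
  \<open>d * d * (a + b) = (a * a - b * b) * d \<le> 0\<close>. Since \<open>d \<le> a + b\<close>,
  this forces the cube of \<open>d\<close> to vanish.\<close>

lemma square_le_imp_le:
  fixes a b :: 'a
  assumes "0 \<le> a" "0 \<le> b" "a * a \<le> b * b"
  shows "a \<le> b"
proof -
  define d where "d = pprt (a - b)"
  have d0: "0 \<le> d" by (simp add: d_def)
  have da: "d \<le> a + b"
    unfolding d_def using assms by (intro pprt_le) (auto simp: diff_le_eq add_increasing2 add.assoc)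
  have "pprt (- (a - b)) * d = 0"
    using disjoint_mult_eq_0[OF inf_pprt_pprt_uminus[of "a - b"]] by (simp only: d_def f_mult_commute)
  moreover have "a - b = d - pprt (- (a - b))"
    unfolding d_def by (rule pprt_minus_pprt_uminus[symmetric])
  ultimately have "(a - b) * d = d * d"
    by (metis diff_zero left_diff_distrib)
  then have "d * d * (a + b) = (a - b) * (d * (a + b))"
    by (simp only: mult.assoc[symmetric])
  also have "\<dots> = ((a - b) * (a + b)) * d"
    by (simp only: mult.assoc f_mult_commute[of d])
  also have "(a - b) * (a + b) = a * a - b * b"
    by (simp add: algebra_simps f_mult_commute[of b a])
  also have "(a * a - b * b) * d \<le> 0"
    using f_mult_nonneg[of "b * b - a * a" d] assms(3) d0 by (simp add: algebra_simps)
  finally have "d * d * (a + b) \<le> 0" .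
  moreover have "d * d * d \<le> d * d * (a + b)"
    using d0 da by (intro f_mult_mono f_mult_nonneg) auto
  moreover have "0 \<le> d * d * d"
    using d0 by (intro f_mult_nonneg)
  ultimately have "d * d * d = 0" by (meson antisym order_trans)
  from cube_eq_0[OF this] have "a - b \<le> 0"
    by (simp add: d_def le_zero_iff_zero_pprt)
  then show ?thesis by simp
qed

lemma fsqrt_square: "0 \<le> a \<Longrightarrow> fsqrt (a * a) = (a :: 'a)"
  unfolding fsqrt_def
proof (rule the_equality)
  fix b assume "0 \<le> a" "0 \<le> b \<and> b * b = a * a"
  then show "b = a" using square_le_imp_le[of a b] square_le_imp_le[of b a] by simp
qed simp

lemma mult_square: "(a * b) * (a * b) = (a * a) * (b * (b :: 'a))"
  by (metis f_mult_commute mult.assoc)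

section \<open>Square roots and the geometric mean\<close>

context
  assumes sqrt_closed: "sqrt_closed TYPE('a)"
begin

lemma fsqrt_nonneg: "0 \<le> a \<Longrightarrow> 0 \<le> fsqrt (a :: 'a)"
  and fsqrt_mult_self: "0 \<le> a \<Longrightarrow> fsqrt (a :: 'a) * fsqrt a = a"
  using sqrt_closed fsqrt_square unfolding sqrt_closed_def by metis+

text \<open>With roots \<open>a\<close>, \<open>b\<close> of \<open>u\<close>, \<open>v\<close>, the
  weighted sum exceeds \<open>2 *\<^sub>R (a * b)\<close> by a positive multiple of the square of
  \<open>\<theta> *\<^sub>R a - b\<close>. The grid estimate shows that these squares have no
  positive lower bound except zero.\<close>

lemma is_infimum_weighted_sum:
  fixes u v :: 'a
  assumes u: "0 \<le> u" and v: "0 \<le> v"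
  shows "is_infimum {\<theta> *\<^sub>R u + inverse \<theta> *\<^sub>R v | \<theta>::real. 0 < \<theta>} (2 *\<^sub>R fsqrt (u * v))"
proof -
  define a b where "a = fsqrt u" and "b = fsqrt v"
  have a: "0 \<le> a" "a * a = u" and b: "0 \<le> b" "b * b = v"
    using u v by (auto simp: a_def b_def fsqrt_nonneg fsqrt_mult_self)
  have uv: "fsqrt (u * v) = a * b"
    using a b fsqrt_square[of "a * b"] f_mult_nonneg[of a b] by (simp add: mult_square)
  have expand: "(\<alpha> *\<^sub>R a - \<beta> *\<^sub>R b) * (\<alpha> *\<^sub>R a - \<beta> *\<^sub>R b)
      = (\<alpha> * \<alpha>) *\<^sub>R u + (\<beta> * \<beta>) *\<^sub>R v - (2 * \<alpha> * \<beta>) *\<^sub>R (a * b)" for \<alpha> \<beta> :: real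
  proof -
    have "(\<alpha> *\<^sub>R a - \<beta> *\<^sub>R b) * (\<alpha> *\<^sub>R a - \<beta> *\<^sub>R b)
      = (\<alpha> * \<alpha>) *\<^sub>R (a * a) + (\<beta> * \<beta>) *\<^sub>R (b * b) - ((\<alpha> * \<beta>) *\<^sub>R (a * b) + (\<alpha> * \<beta>) *\<^sub>R (a * b))"
      by (simp add: algebra_simps f_mult_commute[of b a])
    then show ?thesis
      by (simp add: a b mult.assoc flip: scaleR_add_left)
  qed
  have lower: "2 *\<^sub>R (a * b) \<le> \<theta> *\<^sub>R u + inverse \<theta> *\<^sub>R v" if "0 < \<theta>" for \<theta> :: real
  proof -
    have "0 \<le> inverse \<theta> *\<^sub>R ((\<theta> *\<^sub>R a - 1 *\<^sub>R b) * (\<theta> *\<^sub>R a - 1 *\<^sub>R b))"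
      using that by (intro scaleR_nonneg_nonneg f_square_nonneg) auto
    also have "\<dots> = \<theta> *\<^sub>R u + inverse \<theta> *\<^sub>R v - 2 *\<^sub>R (a * b)"
      unfolding expand using that by (simp add: scaleR_add_right scaleR_diff_right field_simps)
    finally show ?thesis by simp
  qed
  have greatest: "l \<le> 2 *\<^sub>R (a * b)"
    if l: "\<And>\<theta>::real. 0 < \<theta> \<Longrightarrow> l \<le> \<theta> *\<^sub>R u + inverse \<theta> *\<^sub>R v" for l
  proof -
    define d where "d = pprt (l - 2 *\<^sub>R (a * b))"
    define e where "e = fsqrt d"
    have d0: "0 \<le> d" by (simp add: d_def)
    have e: "0 \<le> e" "e * e = d" using d0 by (auto simp: e_def fsqrt_nonneg fsqrt_mult_self)
    have dle: "d \<le> \<theta> *\<^sub>R u + inverse \<theta> *\<^sub>R v - 2 *\<^sub>R (a * b)" if "0 < \<theta>" for \<theta> :: real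
      unfolding d_def using l[OF that] lower[OF that] by (intro pprt_le) auto
    define s where "s = a + b"
    have s0: "0 \<le> s" using a b by (simp add: s_def)
    have "e = 0"
    proof (rule archimedean_pos[OF e(1)])
      fix m :: nat
      assume m: "0 < m"
      define n where "n = m * m + 1"
      have "real m *\<^sub>R e \<le> modulus (real n *\<^sub>R b - real k *\<^sub>R s)" if k: "1 \<le> k" "k \<le> n - 1" for k
      proof (rule square_le_imp_le)
        define j where "j = n - k"
        have j: "1 \<le> j" and nkj: "n = k + j" using k by (auto simp: j_def n_def)
        have "m * m \<le> k * j"
        proof -
          have "k + j \<le> k * j + 1" using k(1) j by (cases k; cases j) auto
          then show ?thesis using nkj by (simp add: n_def)
        qed
        then have mkj: "real m * real m \<le> real k * real j"
          by (metis of_nat_le_iff of_nat_mult)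
        have "(real m *\<^sub>R e) * (real m *\<^sub>R e) = (real m * real m) *\<^sub>R d"
          by (simp add: e)
        also have "\<dots> \<le> (real k * real j) *\<^sub>R d"
          using mkj d0 by (rule scaleR_right_mono)
        \<comment> \<open>The choice \<open>\<theta> = k / j\<close> turns the bound into a perfect
          square.\<close>
        also have "\<dots> \<le> (real k * real j) *\<^sub>R ((real k / real j) *\<^sub>R u
            + inverse (real k / real j) *\<^sub>R v - 2 *\<^sub>R (a * b))"
          using k(1) j by (intro scaleR_left_mono dle) auto
        also have "\<dots> = (real k *\<^sub>R a - real j *\<^sub>R b) * (real k *\<^sub>R a - real j *\<^sub>R b)"
          unfolding expand using k(1) j by (simp add: scaleR_add_right scaleR_diff_right field_simps)
        also have "real k *\<^sub>R a - real j *\<^sub>R b = - (real n *\<^sub>R b - real k *\<^sub>R s)"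
          by (simp add: nkj s_def algebra_simps)
        finally show "(real m *\<^sub>R e) * (real m *\<^sub>R e)
            \<le> modulus (real n *\<^sub>R b - real k *\<^sub>R s) * modulus (real n *\<^sub>R b - real k *\<^sub>R s)"
          by (simp only: modulus_square minus_mult_minus)
      qed (use e in \<open>auto intro: modulus_nonneg scaleR_nonneg_nonneg\<close>)
      \<comment> \<open>The grid stops at \<open>n - 1\<close>, since \<open>k = n\<close> would
        give \<open>j = 0\<close>; the missing point costs one extra \<open>s\<close>.\<close>
      then have "real m *\<^sub>R e \<le> pprt (real n *\<^sub>R b - real (n - 1) *\<^sub>R s) + s"
        using s0 b(1) m by (intro grid_bound) (auto simp: n_def intro: scaleR_nonneg_nonneg)
      also have "\<dots> \<le> s + s"
      proof (intro add_right_mono pprt_le s0)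
        have "real n *\<^sub>R b \<le> real n *\<^sub>R s"
          using a by (intro scaleR_left_mono) (auto simp: s_def)
        also have "real n *\<^sub>R s = s + real (n - 1) *\<^sub>R s"
          by (simp add: n_def algebra_simps)
        finally show "real n *\<^sub>R b - real (n - 1) *\<^sub>R s \<le> s"
          by (simp add: diff_le_eq)
      qed
      finally show "real m *\<^sub>R e \<le> s + s" .
    qed
    with e have "d = 0" by simp
    then show ?thesis by (simp add: d_def flip: le_zero_iff_zero_pprt)
  qed
  show ?thesis
    unfolding is_infimum_def uv using lower greatest by blast
qed

lemma boxtimes_eq_fsqrt: "0 \<le> u \<Longrightarrow> 0 \<le> v \<Longrightarrow> boxtimes u v = fsqrt (u * (v :: 'a))"
  unfolding boxtimes_def by (simp add: is_infimum_The[OF is_infimum_weighted_sum])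

end

end

section \<open>The refined triangle inequality and its equality case\<close>

theorem theorem3p4:
  fixes T :: "'v::real_vector \<Rightarrow> 'v \<Rightarrow> 'f::f_algebra"
    and u :: 'f and x y :: 'v
  assumes "semiprime TYPE('f)" and "sqrt_closed TYPE('f)"
    and "vector_semi_inner_product T"
    and "0 \<le> u"
  defines "S \<equiv> {inverse \<bar>l\<bar> *\<^sub>R (Tnorm T u (l *\<^sub>R x - y) * Tnorm T u (l *\<^sub>R x - y))
                 | l::real. l \<noteq> 0}"
  shows "(\<exists>m. is_infimum S m)
    \<and> Tnorm T u (x + y) \<le> fsqrt ((Tnorm T u x + Tnorm T u y) * (Tnorm T u x + Tnorm T u y)
                                   - (THE m. is_infimum S m))
    \<and> fsqrt ((Tnorm T u x + Tnorm T u y) * (Tnorm T u x + Tnorm T u y) - (THE m. is_infimum S m))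
        \<le> Tnorm T u x + Tnorm T u y
    \<and> (Tnorm T u (x + y) = fsqrt ((Tnorm T u x + Tnorm T u y) * (Tnorm T u x + Tnorm T u y)
                                   - (THE m. is_infimum S m))
       \<longleftrightarrow> 0 \<le> T x y * u)"
proof -
  note sp = assms(1) and sc = assms(2)
  note root = fsqrt_nonneg[OF sp sc] fsqrt_mult_self[OF sp sc]
  have bil: "bilinear T" and sym: "T a b = T b a" and pos: "0 \<le> T a a" for a b
    using assms(3) by (auto simp: vector_semi_inner_product_def)
  define N where "N = Tnorm T u"
  have Txu: "0 \<le> T z z * u" for z
    by (intro f_mult_nonneg pos assms)
  have N: "N z = fsqrt (T z z * u)" for z
    by (simp add: N_def Tnorm_def boxtimes_eq_fsqrt[OF sp sc pos assms(4)])
  have N0: "0 \<le> N z" and NN: "N z * N z = T z z * u" for z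
    using root Txu by (simp_all add: N)
  define A C D where "A = T x x * u" and "C = T y y * u" and "D = T x y * u"
  have A: "0 \<le> A" and C: "0 \<le> C" by (simp_all add: A_def C_def Txu)
  define r where "r = fsqrt (A * C)"
  have r: "r = N x * N y"
    using fsqrt_square[OF sp f_mult_nonneg[OF N0 N0]]
    by (simp add: r_def A_def C_def mult_square[OF sp] NN)
  have sum: "N (x + y) * N (x + y) = A + C + 2 *\<^sub>R D"
    unfolding NN A_def C_def D_def
    by (simp add: bilinear_ladd[OF bil] bilinear_radd[OF bil] sym[of y x] algebra_simps scaleR_2)
  have diff: "N (l *\<^sub>R x - y) * N (l *\<^sub>R x - y) = (l * l) *\<^sub>R A + C - (2 * l) *\<^sub>R D" for l
    unfolding NN A_def C_def D_def
    by (simp add: bilinear_lsub[OF bil] bilinear_rsub[OF bil] bilinear_lmul[OF bil]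
        bilinear_rmul[OF bil] sym[of y x] algebra_simps scaleR_2 flip: scaleR_scaleR)
  \<comment> \<open>Dividing by the modulus of \<open>l\<close> gives the weighted sums with infimum
    \<open>2 *\<^sub>R r\<close>, shifted by \<open>- 2 *\<^sub>R D\<close> for positive
    \<open>l\<close> and by \<open>2 *\<^sub>R D\<close> for negative \<open>l\<close>.\<close>
  have S_pos: "inverse \<bar>l\<bar> *\<^sub>R (N (l *\<^sub>R x - y) * N (l *\<^sub>R x - y))
      = (l *\<^sub>R A + inverse l *\<^sub>R C) - 2 *\<^sub>R D" if "0 < l" for l
    unfolding diff using that by (simp add: scaleR_add_right scaleR_diff_right field_simps)
  have S_neg: "inverse \<bar>l\<bar> *\<^sub>R (N (l *\<^sub>R x - y) * N (l *\<^sub>R x - y))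
      = ((- l) *\<^sub>R A + inverse (- l) *\<^sub>R C) + 2 *\<^sub>R D" if "l < 0" for l
    unfolding diff using that by (simp add: scaleR_add_right scaleR_diff_right field_simps)
  \<comment> \<open>The two signs contribute the infima \<open>2 *\<^sub>R r - 2 *\<^sub>R D\<close>
    and \<open>2 *\<^sub>R r + 2 *\<^sub>R D\<close>; \<open>m\<close> is their infimum.\<close>
  define m where "m = 2 *\<^sub>R r - 2 *\<^sub>R modulus D"
  note inf_AC = is_infimum_weighted_sum[OF sp sc A C, folded r_def, unfolded is_infimum_def]
  have r_le: "2 *\<^sub>R r \<le> \<theta> *\<^sub>R A + inverse \<theta> *\<^sub>R C" if "0 < \<theta>" for \<theta> :: real
    using inf_AC that by blast
  have le_r: "l \<le> 2 *\<^sub>R r" if "\<And>\<theta>::real. 0 < \<theta> \<Longrightarrow> l \<le> \<theta> *\<^sub>R A + inverse \<theta> *\<^sub>R C" for l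
    using inf_AC that by blast
  have mS: "is_infimum S m"
    unfolding is_infimum_def
  proof (intro conjI ballI allI impI)
    fix s assume "s \<in> S"
    then obtain l :: real where l: "l \<noteq> 0"
      and s: "s = inverse \<bar>l\<bar> *\<^sub>R (N (l *\<^sub>R x - y) * N (l *\<^sub>R x - y))"
      unfolding S_def N_def by blast
    have D2: "2 *\<^sub>R D \<le> 2 *\<^sub>R modulus D" "2 *\<^sub>R (- D) \<le> 2 *\<^sub>R modulus D"
      by (intro scaleR_left_mono modulus_ge; simp)+
    show "m \<le> s"
    proof (cases "0 < l")
      case True
      show ?thesis
        unfolding s S_pos[OF True] m_def using r_le[OF True] D2(1) by (rule diff_mono)
    next
      case False
      with l have l: "l < 0" by simp
      show ?thesis
        unfolding s S_neg[OF l] m_def using diff_mono[OF r_le[of "- l"] D2(2)] l by simp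
    qed
  next
    fix q assume q: "\<forall>s\<in>S. q \<le> s"
    then have q': "q \<le> inverse \<bar>l\<bar> *\<^sub>R (N (l *\<^sub>R x - y) * N (l *\<^sub>R x - y))" if "l \<noteq> 0" for l
      using that unfolding S_def N_def by blast
    have "q + 2 *\<^sub>R D \<le> 2 *\<^sub>R r"
    proof (rule le_r)
      fix \<theta> :: real assume "0 < \<theta>"
      then show "q + 2 *\<^sub>R D \<le> \<theta> *\<^sub>R A + inverse \<theta> *\<^sub>R C"
        using q'[of \<theta>] S_pos[of \<theta>] by (simp add: le_diff_eq)
    qed
    moreover have "q - 2 *\<^sub>R D \<le> 2 *\<^sub>R r"
    proof (rule le_r)
      fix \<theta> :: real assume "0 < \<theta>"
      then show "q - 2 *\<^sub>R D \<le> \<theta> *\<^sub>R A + inverse \<theta> *\<^sub>R C"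
        using q'[of "- \<theta>"] S_neg[of "- \<theta>"] by (simp add: diff_le_eq)
    qed
    ultimately have "D \<le> (1/2) *\<^sub>R (2 *\<^sub>R r - q)" "- D \<le> (1/2) *\<^sub>R (2 *\<^sub>R r - q)"
      using scaleR_left_mono[of "2 *\<^sub>R D" "2 *\<^sub>R r - q" "1/2"]
        scaleR_left_mono[of "- (2 *\<^sub>R D)" "2 *\<^sub>R r - q" "1/2"]
      by (simp_all add: algebra_simps)
    then have "modulus D \<le> (1/2) *\<^sub>R (2 *\<^sub>R r - q)" by (rule modulus_le)
    then have "2 *\<^sub>R modulus D \<le> 2 *\<^sub>R ((1/2) *\<^sub>R (2 *\<^sub>R r - q))"
      by (rule scaleR_left_mono) simp
    then show "q \<le> m" by (simp add: m_def algebra_simps)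
  qed
  have m0: "0 \<le> m"
  proof -
    have "\<forall>s\<in>S. 0 \<le> s"
      unfolding S_def by (auto intro!: scaleR_nonneg_nonneg f_square_nonneg[OF sp])
    with mS show ?thesis by (simp add: is_infimum_def)
  qed
  define Q where "Q = (N x + N y) * (N x + N y) - m"
  \<comment> \<open>The cross term \<open>2 *\<^sub>R r\<close> is exactly what \<open>m\<close>
    removes, leaving \<open>2 *\<^sub>R modulus D\<close> in \<open>Q\<close>.\<close>
  have Nxy: "(N x + N y) * (N x + N y) = A + C + 2 *\<^sub>R r"
    by (simp add: algebra_simps NN A_def C_def r f_mult_commute[OF sp, of "N y"] scaleR_2)
  have Q: "Q = A + C + 2 *\<^sub>R modulus D"
    by (simp add: Q_def Nxy m_def)
  have D2: "2 *\<^sub>R D \<le> 2 *\<^sub>R modulus D"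
    by (intro scaleR_left_mono modulus_ge) simp
  have Q0: "0 \<le> Q"
    unfolding Q using A C by (intro add_nonneg_nonneg scaleR_nonneg_nonneg modulus_nonneg) auto
  have "N (x + y) \<le> fsqrt Q"
    by (rule square_le_imp_le[OF sp])
      (use root Q0 N0 D2 in \<open>simp_all add: sum Q\<close>)
  moreover have "fsqrt Q \<le> N x + N y"
    by (rule square_le_imp_le[OF sp])
      (use root Q0 N0 m0 in \<open>simp_all add: Q_def\<close>)
  moreover have "N (x + y) = fsqrt Q \<longleftrightarrow> 0 \<le> D"
  proof
    assume "N (x + y) = fsqrt Q"
    then have "A + C + 2 *\<^sub>R D = Q"
      using sum root(2)[OF Q0] by simp
    then have "D = modulus D" by (simp add: Q)
    then show "0 \<le> D" by (metis modulus_nonneg)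
  next
    assume "0 \<le> D"
    then have "modulus D = D" by (simp add: modulus_def)
    then have "Q = N (x + y) * N (x + y)" by (simp add: Q sum)
    then show "N (x + y) = fsqrt Q" by (simp add: fsqrt_square[OF sp N0])
  qed
  ultimately show ?thesis
    unfolding is_infimum_The[OF mS] using mS unfolding Q_def N_def D_def by blast
qed

end
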